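(* Let $G$ be a finite simple connected graph of diameter $d$ and let $1\le i\le d$. If $G$ is $i$-CDDR and the $i$-th distance graph $G_i$ is connected, then $G$ is DDR.
   Context: $\Gamma_j(u)$ is the set of vertices at distance exactly $j$ from $u$. The $i$-th distance graph $G_i$ has vertex set $V(G)$, with $u,v$ adjacent iff $d_G(u,v)=i$. $G$ is $i$-CDDR if $|\Gamma_i(u)\cap\Gamma_j(v)|=|\Gamma_i(v)\cap\Gamma_j(u)|$ for all vertices $u,v$ and all $1\le j\le\operatorname{diam}(G)$; equivalently the $i$-th distance matrix $A_i(G)$ (with $(u,v)$-entry $1$ iff $d(u,v)=i$, else $0$) commutes with every distance matrix $A_j(G)$, $0\le j\le\operatorname{diam}(G)$. $G$ is DDR (distance degree-regular) if $|\Gamma_j(u)|=|\Gamma_j(v)|$ for all vertices $u,v$ and all $j$. *)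

theory Defs
  imports "Graph_Theory.Graph_Theory"
begin

text \<open>
  Finite simple graphs are the library's \<^locale>\<open>graph\<close>: finite, loop-free, symmetric
  digraphs without parallel arcs, so each undirected edge is a pair of opposite arcs.
\<close>

text \<open>Shortest-path distance with unit arc weights; it is \<open>\<infinity>\<close> between different components.\<close>

definition gdist :: "('a, 'b) pre_digraph \<Rightarrow> 'a \<Rightarrow> 'a \<Rightarrow> ereal" where
  "gdist G u v = wf_digraph.\<mu> G (\<lambda>_. 1) u v"

lemma (in wf_digraph) gdist_eq_INF_length:
  "gdist G u v = (INF p\<in>{p. awalk u p v}. ereal (real (length p)))"
proof -
  have "awalk_cost (\<lambda>_. 1) p = real (length p)" for p
    by (induction p) auto
  then show ?thesis
    by (simp add: gdist_def \<mu>_def)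
qed

definition gdiam :: "('a, 'b) pre_digraph \<Rightarrow> ereal" where
  "gdiam G = (SUP (u, v)\<in>verts G \<times> verts G. gdist G u v)"

definition sphere_at :: "('a, 'b) pre_digraph \<Rightarrow> nat \<Rightarrow> 'a \<Rightarrow> 'a set" where
  "sphere_at G j u = {v \<in> verts G. gdist G u v = ereal (real j)}"

definition distance_graph :: "('a, 'b) pre_digraph \<Rightarrow> nat \<Rightarrow> 'a pair_pre_digraph" where
  "distance_graph G i = \<lparr> pverts = verts G,
     parcs = {(u, v) \<in> verts G \<times> verts G. gdist G u v = ereal (real i)} \<rparr>"

definition CDDR :: "('a, 'b) pre_digraph \<Rightarrow> nat \<Rightarrow> bool" where
  "CDDR G i \<longleftrightarrow> (\<forall>u\<in>verts G. \<forall>v\<in>verts G. \<forall>j::nat. 1 \<le> j \<and> ereal (real j) \<le> gdiam G \<longrightarrow>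
     card (sphere_at G i u \<inter> sphere_at G j v) = card (sphere_at G i v \<inter> sphere_at G j u))"

definition DDR :: "('a, 'b) pre_digraph \<Rightarrow> bool" where
  "DDR G \<longleftrightarrow> (\<forall>u\<in>verts G. \<forall>v\<in>verts G. \<forall>j::nat.
     card (sphere_at G j u) = card (sphere_at G j v))"

end

theory Submission
  imports Defs
begin

text \<open>
  Write \<open>k\<^sub>j(u)\<close> for the number of vertices at distance \<open>j\<close> from \<open>u\<close>.  Each \<open>k\<^sub>j\<close> turns out to be a
  harmonic function on the connected graph \<open>G\<^sub>i\<close>, and therefore constant.

  \<^item> \<open>G\<^sub>i\<close> is regular: the spheres of radius \<open>1, \<dots>, d\<close> around \<open>v\<close> partition the vertices other
    than \<open>v\<close>, so summing the CDDR identity over these radii gives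
    \<open>|\<Gamma>\<^sub>i(u) - {v}| = |\<Gamma>\<^sub>i(v) - {u}|\<close>; as \<open>v \<in> \<Gamma>\<^sub>i(u)\<close> iff \<open>u \<in> \<Gamma>\<^sub>i(v)\<close>, this says
    \<open>k\<^sub>i(u) = k\<^sub>i(v)\<close> (lemma \<open>CDDR_imp_distance_graph_regular\<close>).
  \<^item> \<open>k\<^sub>j\<close> is harmonic: summing the CDDR identity for a fixed \<open>j\<close> over all \<open>v\<close> and counting both
    sides in the other order (lemma \<open>sum_card_Int_symmetric\<close>) gives
    \<open>\<Sum>w\<in>\<Gamma>\<^sub>i(u). k\<^sub>j(w) = k\<^sub>j(u) \<cdot> k\<^sub>i\<close>.  So \<open>k\<^sub>j(u)\<close> is the average of \<open>k\<^sub>j\<close> over the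
    \<open>G\<^sub>i\<close>-neighbours of \<open>u\<close>.  In matrix terms, this is \<open>A\<^sub>i A\<^sub>j = A\<^sub>j A\<^sub>i\<close> applied to the all-ones
    vector.
  \<^item> By the maximum principle (lemma \<open>harmonic_imp_constant\<close>), \<open>k\<^sub>j\<close> is constant.
\<close>

section \<open>Harmonic functions and double counting\<close>

text \<open>
  Maximum principle: at a vertex where \<open>f\<close> is maximal, the mean value property forces every
  neighbour to be maximal as well, and this propagates along walks.
\<close>

lemma harmonic_imp_constant:
  fixes f :: "'a \<Rightarrow> nat"
  assumes fin: "finite V"
    and sub: "\<And>u. u \<in> V \<Longrightarrow> N u \<subseteq> V"
    and harmonic: "\<And>u. u \<in> V \<Longrightarrow> (\<Sum>w\<in>N u. f w) = card (N u) * f u"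
    and conn: "\<And>u v. u \<in> V \<Longrightarrow> v \<in> V \<Longrightarrow> (u, v) \<in> {(x, y). x \<in> V \<and> y \<in> N x}\<^sup>*"
    and "u \<in> V" "v \<in> V"
  shows "f u = f v"
proof -
  define M where "M = Max (f ` V)"
  have le: "f x \<le> M" if "x \<in> V" for x
    using that fin by (simp add: M_def)
  have "M \<in> f ` V"
    unfolding M_def using fin \<open>u \<in> V\<close> by (intro Max_in) auto
  then obtain m where m: "m \<in> V" "f m = M" by auto
  have max_step: "f y = M" if x: "x \<in> V" "f x = M" and y: "y \<in> N x" for x y
  proof (rule ccontr)
    assume "f y \<noteq> M"
    then have "f y < M" using le[of y] sub[OF x(1)] y by force
    moreover have "finite (N x)" using sub[OF x(1)] fin finite_subset by blast
    ultimately have "(\<Sum>w\<in>N x. f w) < (\<Sum>w\<in>N x. M)"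
      using le sub[OF x(1)] y by (intro sum_strict_mono_ex1) auto
    then show False using harmonic[OF x(1)] x(2) by simp
  qed
  have "f x = M" if "x \<in> V" for x
    using conn[OF m(1) that]
  proof (induction rule: rtrancl_induct)
    case base
    show ?case by (rule m(2))
  next
    case (step y z)
    then show ?case using max_step[of y z] by blast
  qed
  then show ?thesis using \<open>u \<in> V\<close> \<open>v \<in> V\<close> by simp
qed

text \<open>Both sides count the pairs \<open>(v, w)\<close> with \<open>w \<in> A\<close> in the symmetric relation given by \<open>S\<close>.\<close>

lemma sum_card_Int_symmetric:
  assumes fin: "finite V" and A: "A \<subseteq> V"
    and sub: "\<And>v. v \<in> V \<Longrightarrow> S v \<subseteq> V"
    and sym: "\<And>v w. v \<in> V \<Longrightarrow> w \<in> V \<Longrightarrow> w \<in> S v \<longleftrightarrow> v \<in> S w"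
  shows "(\<Sum>v\<in>V. card (A \<inter> S v)) = (\<Sum>w\<in>A. card (S w))"
proof -
  have finA: "finite A" using A fin finite_subset by blast
  have "(\<Sum>v\<in>V. card (A \<inter> S v)) = (\<Sum>v\<in>V. \<Sum>w\<in>A. if w \<in> S v then 1 else 0)"
    using finA by (simp add: sum.If_cases Int_def)
  also have "\<dots> = (\<Sum>w\<in>A. \<Sum>v\<in>V. if w \<in> S v then 1 else 0)"
    by (rule sum.swap)
  also have "\<dots> = (\<Sum>w\<in>A. card (S w))"
  proof (rule sum.cong[OF refl])
    fix w assume w: "w \<in> A"
    then have "V \<inter> {v. w \<in> S v} = S w" using A sub sym by blast
    then show "(\<Sum>v\<in>V. if w \<in> S v then 1 else 0) = card (S w)"
      using fin by (simp add: sum.If_cases)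
  qed
  finally show ?thesis .
qed

section \<open>Distances and spheres\<close>

text \<open>
  Walk lengths are natural numbers, so the infimum that defines a finite distance is a minimum;
  in particular finite distances are natural numbers.
\<close>

lemma (in wf_digraph) gdist_attained:
  assumes "gdist G u v \<noteq> \<infinity>"
  obtains p where "awalk u p v" "gdist G u v = ereal (real (length p))"
proof -
  have "{p. awalk u p v} \<noteq> {}"
    using assms unfolding gdist_eq_INF_length by (metis INF_empty top_ereal_def)
  then obtain q where q: "awalk u q v" by blast
  obtain p where p: "awalk u p v" "\<And>q. awalk u q v \<Longrightarrow> length p \<le> length q"
    using ex_has_least_nat[of "\<lambda>p. awalk u p v" q length] q by blast
  have "gdist G u v = ereal (real (length p))"
    unfolding gdist_eq_INF_length
    by (rule antisym) (auto intro!: INF_lower2[of p] INF_greatest simp: p)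
  with p(1) show thesis by (rule that)
qed

lemma (in wf_digraph) gdist_le_length:
  "awalk u p v \<Longrightarrow> gdist G u v \<le> ereal (real (length p))"
  unfolding gdist_eq_INF_length by (auto intro: INF_lower2)

lemma (in sym_digraph) ex_reverse_awalk:
  assumes "awalk u p v"
  shows "\<exists>q. awalk v q u \<and> length q = length p"
  using assms
proof (induction p arbitrary: u)
  case Nil
  then show ?case by (auto simp: awalk_Nil_iff)
next
  case (Cons e es)
  then have e: "e \<in> arcs G" "u = tail G e" "awalk (head G e) es v"
    by (auto simp: awalk_Cons_iff)
  then obtain q where q: "awalk v q (head G e)" "length q = length es"
    using Cons.IH by blast
  obtain e' where e': "e' \<in> arcs G" "tail G e' = head G e" "head G e' = tail G e"
    using sym_arcs e(1) unfolding symmetric_conv by metis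
  have "awalk v (q @ [e']) u"
    using q(1) e' e(2) arc_implies_awalk[OF e'(1)] by (auto intro: awalk_appendI)
  then show ?case using q(2) by (intro exI[of _ "q @ [e']"]) simp
qed

lemma (in sym_digraph) gdist_commute: "gdist G u v = gdist G v u"
proof -
  have "gdist G v u \<le> gdist G u v" for u v
    unfolding gdist_eq_INF_length[of u v]
    by (rule INF_greatest) (metis ex_reverse_awalk gdist_le_length mem_Collect_eq)
  then show ?thesis by (simp add: antisym)
qed

lemma (in wf_digraph) gdist_eq_0_iff:
  assumes "u \<in> verts G"
  shows "gdist G u v = 0 \<longleftrightarrow> u = v"
proof
  assume 0: "gdist G u v = 0"
  then obtain p where "awalk u p v" "gdist G u v = ereal (real (length p))"
    using gdist_attained[of u v] by auto
  then show "u = v" using 0 by (simp add: awalk_Nil_iff)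
next
  assume "u = v"
  then have "awalk u [] v" using assms by (simp add: awalk_Nil_iff)
  then have "gdist G u v \<le> 0" using gdist_le_length[of u "[]" v] by (simp add: zero_ereal_def)
  moreover have "gdist G u v \<ge> 0"
    unfolding gdist_eq_INF_length by (rule INF_greatest) simp
  ultimately show "gdist G u v = 0" by simp
qed

lemma gdist_le_gdiam:
  "u \<in> verts G \<Longrightarrow> v \<in> verts G \<Longrightarrow> gdist G u v \<le> gdiam G"
  unfolding gdiam_def by (rule SUP_upper2[of "(u, v)"]) auto

text \<open>
  The diameter bounds every distance, so a finite diameter rules out the value \<open>\<infinity>\<close>, and every
  vertex lies on some sphere around any other.
\<close>

lemma (in wf_digraph) gdist_nat_if_gdiam_finite:
  assumes "gdiam G = ereal (real d)" "u \<in> verts G" "v \<in> verts G"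
  obtains n where "n \<le> d" "gdist G u v = ereal (real n)"
proof -
  have le: "gdist G u v \<le> ereal (real d)"
    using gdist_le_gdiam[OF assms(2,3)] assms(1) by simp
  then have "gdist G u v \<noteq> \<infinity>" by auto
  then obtain p where "awalk u p v" "gdist G u v = ereal (real (length p))"
    by (rule gdist_attained)
  then show thesis using le that[of "length p"] by simp
qed

lemma sphere_at_subset: "sphere_at G j u \<subseteq> verts G"
  by (auto simp: sphere_at_def)

lemma (in sym_digraph) sphere_at_sym:
  "u \<in> verts G \<Longrightarrow> v \<in> verts G \<Longrightarrow> v \<in> sphere_at G j u \<longleftrightarrow> u \<in> sphere_at G j v"
  by (auto simp: sphere_at_def gdist_commute)

lemma (in wf_digraph) sphere_at_0: "u \<in> verts G \<Longrightarrow> sphere_at G 0 u = {u}"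
  by (auto simp: sphere_at_def gdist_eq_0_iff zero_ereal_def[symmetric])

lemma sphere_at_beyond_gdiam:
  assumes "gdiam G < ereal (real j)" "u \<in> verts G"
  shows "sphere_at G j u = {}"
  using assms gdist_le_gdiam[of u G] by (fastforce simp: sphere_at_def)

lemma (in wf_digraph) spheres_partition:
  assumes "gdiam G = ereal (real d)" "v \<in> verts G"
  shows "(\<Union>j\<in>{1..d}. sphere_at G j v) = verts G - {v}"
proof -
  have "w \<in> (\<Union>j\<in>{1..d}. sphere_at G j v)" if w: "w \<in> verts G" "w \<noteq> v" for w
  proof -
    obtain n where n: "n \<le> d" "gdist G v w = ereal (real n)"
      using gdist_nat_if_gdiam_finite assms w(1) by metis
    then have "n \<noteq> 0" using gdist_eq_0_iff[OF assms(2), of w] w(2) by (auto simp: zero_ereal_def)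
    with n w show ?thesis by (auto simp: sphere_at_def)
  qed
  moreover have "v \<notin> (\<Union>j\<in>{1..d}. sphere_at G j v)"
    using gdist_eq_0_iff[OF assms(2), of v] by (auto simp: sphere_at_def zero_ereal_def)
  ultimately show ?thesis using sphere_at_subset[of G] by blast
qed

section \<open>Sphere sizes are harmonic on the distance graph\<close>

text \<open>
  The spheres around \<open>v\<close> cut \<open>A\<close> into disjoint pieces, so the sum over the radii measures \<open>A\<close>
  itself, except that radius \<open>0\<close>, for which CDDR says nothing, is left out.
\<close>

lemma (in fin_digraph) sum_card_Int_spheres:
  assumes "gdiam G = ereal (real d)" "v \<in> verts G" "A \<subseteq> verts G"
  shows "(\<Sum>j\<in>{1..d}. card (A \<inter> sphere_at G j v)) = card (A - {v})"
proof -
  have "finite A" using assms(3) finite_verts finite_subset by blast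
  then have "(\<Sum>j\<in>{1..d}. card (A \<inter> sphere_at G j v)) = card (\<Union>j\<in>{1..d}. A \<inter> sphere_at G j v)"
    by (intro card_UN_disjoint[symmetric]) (auto simp: sphere_at_def)
  also have "(\<Union>j\<in>{1..d}. A \<inter> sphere_at G j v) = A - {v}"
    using spheres_partition[OF assms(1,2)] assms(3) by (simp flip: Int_UN_distrib) blast
  finally show ?thesis .
qed

text \<open>
  Summing the CDDR identity over all radii loses the position of the other vertex, so only the
  sizes of \<open>\<Gamma>\<^sub>i(u) - {v}\<close> and \<open>\<Gamma>\<^sub>i(v) - {u}\<close> are compared; by symmetry of the distance, either
  both removals take away a vertex or neither does.
\<close>

lemma (in graph) CDDR_imp_distance_graph_regular:
  assumes diam: "gdiam G = ereal (real d)" and cddr: "CDDR G i"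
    and u: "u \<in> verts G" and v: "v \<in> verts G"
  shows "card (sphere_at G i u) = card (sphere_at G i v)"
proof -
  have "card (sphere_at G i u - {v}) = (\<Sum>j\<in>{1..d}. card (sphere_at G i u \<inter> sphere_at G j v))"
    using sum_card_Int_spheres[OF diam v sphere_at_subset] by simp
  also have "\<dots> = (\<Sum>j\<in>{1..d}. card (sphere_at G i v \<inter> sphere_at G j u))"
    using cddr u v diam unfolding CDDR_def by (intro sum.cong) auto
  also have "\<dots> = card (sphere_at G i v - {u})"
    by (rule sum_card_Int_spheres[OF diam u sphere_at_subset])
  finally have eq: "card (sphere_at G i u - {v}) = card (sphere_at G i v - {u})" .
  have fin: "finite (sphere_at G i x)" for x
    using finite_subset[OF sphere_at_subset finite_verts] .
  show ?thesis
  proof (cases "v \<in> sphere_at G i u")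
    case True
    then have "u \<in> sphere_at G i v" using sphere_at_sym u v by blast
    then show ?thesis using eq True fin by (metis card_Suc_Diff1)
  next
    case False
    then have "u \<notin> sphere_at G i v" using sphere_at_sym u v by blast
    then show ?thesis using eq False by simp
  qed
qed

text \<open>
  Double counting turns the sum of \<open>|\<Gamma>\<^sub>i(u) \<inter> \<Gamma>\<^sub>j(v)|\<close> over \<open>v\<close> into the sum of \<open>k\<^sub>j\<close> over
  \<open>\<Gamma>\<^sub>i(u)\<close>, and the CDDR-equal sum of \<open>|\<Gamma>\<^sub>i(v) \<inter> \<Gamma>\<^sub>j(u)|\<close> into the sum of \<open>k\<^sub>i\<close> over
  \<open>\<Gamma>\<^sub>j(u)\<close>, which is a product because \<open>k\<^sub>i\<close> is constant.
\<close>

lemma (in graph) CDDR_imp_sphere_size_harmonic: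
  assumes diam: "gdiam G = ereal (real d)" and cddr: "CDDR G i"
    and j: "1 \<le> j" "j \<le> d" and u: "u \<in> verts G"
  shows "(\<Sum>w\<in>sphere_at G i u. card (sphere_at G j w))
    = card (sphere_at G i u) * card (sphere_at G j u)"
proof -
  have "(\<Sum>w\<in>sphere_at G i u. card (sphere_at G j w))
      = (\<Sum>v\<in>verts G. card (sphere_at G i u \<inter> sphere_at G j v))"
    by (rule sum_card_Int_symmetric[symmetric]) (use sphere_at_subset[of G] sphere_at_sym in auto)
  also have "\<dots> = (\<Sum>v\<in>verts G. card (sphere_at G j u \<inter> sphere_at G i v))"
    using cddr u j diam unfolding CDDR_def
    by (intro sum.cong) (simp_all add: Int_commute[of "sphere_at G j u"])
  also have "\<dots> = (\<Sum>w\<in>sphere_at G j u. card (sphere_at G i w))"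
    by (rule sum_card_Int_symmetric) (use sphere_at_subset[of G] sphere_at_sym in auto)
  also have "\<dots> = (\<Sum>w\<in>sphere_at G j u. card (sphere_at G i u))"
    using CDDR_imp_distance_graph_regular[OF diam cddr _ u] sphere_at_subset[of G j u]
    by (intro sum.cong) auto
  finally show ?thesis by (simp add: mult.commute)
qed

text \<open>
  Connectedness speaks of the symmetric closure of the arcs.  As the distance is symmetric, the
  closure adds nothing to a distance graph.
\<close>

lemma (in sym_digraph) distance_graph_connected_imp_rtrancl:
  assumes "Digraph_Component.connected (with_proj (distance_graph G i))"
    and "u \<in> verts G" "v \<in> verts G"
  shows "(u, v) \<in> {(x, y). x \<in> verts G \<and> y \<in> sphere_at G i x}\<^sup>*"
proof -
  have "parcs (mk_symmetric (with_proj (distance_graph G i)))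
      = {(x, y). x \<in> verts G \<and> y \<in> sphere_at G i x}"
    by (auto simp: parcs_mk_symmetric distance_graph_def sphere_at_def gdist_commute)
  moreover have "u \<rightarrow>\<^sup>*\<^bsub>with_proj (mk_symmetric (with_proj (distance_graph G i)))\<^esub> v"
    using assms by (auto simp: Digraph_Component.connected_def strongly_connected_def
        distance_graph_def)
  ultimately show ?thesis by (auto dest: reachable_rtranclI)
qed

theorem theorem7p2:
  fixes G :: "('a, 'b) pre_digraph" and d i :: nat
  assumes "graph G"
    and "Digraph_Component.connected G"
    and "gdiam G = ereal (real d)"
    and "1 \<le> i" and "i \<le> d"
    and "CDDR G i"
    and "Digraph_Component.connected (with_proj (distance_graph G i))"
  shows "DDR G"
  unfolding DDR_def
proof (intro ballI allI)
  interpret graph G by fact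
  fix u v j assume u: "u \<in> verts G" and v: "v \<in> verts G"
  consider "j = 0" | "1 \<le> j" "j \<le> d" | "d < j" by linarith
  then show "card (sphere_at G j u) = card (sphere_at G j v)"
  proof cases
    case 1
    then show ?thesis using u v by (simp add: sphere_at_0)
  next
    case 2
    show ?thesis
      by (rule harmonic_imp_constant[where N = "sphere_at G i", OF finite_verts sphere_at_subset
            CDDR_imp_sphere_size_harmonic[OF assms(3,6) 2]
            distance_graph_connected_imp_rtrancl[OF assms(7)] u v])
  next
    case 3
    then show ?thesis using u v assms(3) by (simp add: sphere_at_beyond_gdiam)
  qed
qed

end
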